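(* Let $a>0$ with $a\neq 1$, and let $\sigma:\mathbb{R}\to\mathbb{R}$ be a twice differentiable function with $\sigma(t)>0$, $\sigma'(t)>0$ and $\sigma''(t)>0$ for all $t>0$, and such that $$\sigma''(t)\,\sigma(t)\ \ge\ (\sigma'(t))^2\qquad\text{for all } t>0.$$ Let $A\in\mathbb{R}^{N\times N}$ be the adjacency matrix of a graph on $N$ vertices, let $n\ge 1$, let $d_0,\dots,d_n\ge 1$, and let $X\in\mathbb{R}^{N\times d_0}$ have all entries strictly positive. For $W=(W_0,\dots,W_{n-1})$ with $W_k\in\mathbb{R}^{d_k\times d_{k+1}}$, define the $n$-layer exponential graph convolutional network by $X^{(0)}=X$, $$X^{(k+1)}=\sigma\big(A X^{(k)} a^{W_k}\big)\quad (0\le k\le n-2),\qquad f_{a,n}(X,W)=A X^{(n-1)} a^{W_{n-1}}.$$ Then $f_{a,n}(X,W)$ is a Parameter Convex Neural Network, i.e. it is convex with respect to $W$.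
   Context: For a real matrix $M$ and $a>0$, $a^{M}$ denotes the matrix of the same size with entries $a^{M_{ij}}$ (entrywise exponential); products such as $AX^{(k)}a^{W_k}$ are ordinary matrix products. A scalar function $\sigma$ applied to a matrix acts entrywise. A matrix- or vector-valued function of parameters $W$ (a tuple of matrices) is called convex with respect to $W$ if each of its entries is a convex real-valued function of the column vector obtained by listing all the entries of $W$. A neural network $F(X,\theta)$ with input $X$ and parameters $\theta$ is a Parameter Convex Neural Network (PCNN) if it is convex with respect to $\theta$ (for each admissible fixed input $X$). *)

theory Defs
  imports Complex_Main "Jordan_Normal_Form.Matrix" "Graph_Theory.Digraph"
begin

(* The (i, j) entry counts the arcs from i to j; without parallel arcs it is 0 or 1.
   As usual in this library, an undirected graph is a digraph with symmetric arcs. *)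
definition adjacency_mat :: "nat \<Rightarrow> (nat, 'e) pre_digraph \<Rightarrow> real mat" where
  "adjacency_mat N G =
     mat N N (\<lambda>(i, j). real (card {e \<in> arcs G. tail G e = i \<and> head G e = j}))"

definition entrywise_powr :: "real \<Rightarrow> real mat \<Rightarrow> real mat" where
  "entrywise_powr a M = map_mat (\<lambda>x. a powr x) M"

primrec gcn_layer ::
  "(real \<Rightarrow> real) \<Rightarrow> real \<Rightarrow> real mat \<Rightarrow> real mat \<Rightarrow> real mat list \<Rightarrow> nat \<Rightarrow> real mat" where
  "gcn_layer \<sigma> a A X W 0 = X"
| "gcn_layer \<sigma> a A X W (Suc k) =
     map_mat \<sigma> (A * gcn_layer \<sigma> a A X W k * entrywise_powr a (W ! k))"

definition exp_gcn ::
  "(real \<Rightarrow> real) \<Rightarrow> real \<Rightarrow> real mat \<Rightarrow> nat \<Rightarrow> real mat \<Rightarrow> real mat list \<Rightarrow> real mat" where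
  "exp_gcn \<sigma> a A n X W =
     A * gcn_layer \<sigma> a A X W (n - 1) * entrywise_powr a (W ! (n - 1))"

definition param_space :: "nat \<Rightarrow> (nat \<Rightarrow> nat) \<Rightarrow> real mat list set" where
  "param_space n d =
     {W. length W = n \<and> (\<forall>k<n. W ! k \<in> carrier_mat (d k) (d (Suc k)))}"

definition param_dim :: "nat \<Rightarrow> (nat \<Rightarrow> nat) \<Rightarrow> nat" where
  "param_dim n d = (\<Sum>k<n. d k * d (Suc k))"

(* All entries of W_0, ..., W_(n-1), matrix after matrix and row after row. *)
definition param_vec :: "real mat list \<Rightarrow> real vec" where
  "param_vec W = vec_of_list (concat (map (\<lambda>M. concat (mat_to_list M)) W))"

(* Usual convexity on R^m; convex_on does not apply because real vec, which contains
   the vectors of all dimensions, is not an instance of real_vector. *)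
definition convex_on_vec :: "nat \<Rightarrow> (real vec \<Rightarrow> real) \<Rightarrow> bool" where
  "convex_on_vec m g \<longleftrightarrow>
     (\<forall>x\<in>carrier_vec m. \<forall>y\<in>carrier_vec m. \<forall>u\<ge>0. \<forall>v\<ge>0. u + v = 1 \<longrightarrow>
        g (u \<cdot>\<^sub>v x + v \<cdot>\<^sub>v y) \<le> u * g x + v * g y)"

(* g is unique on R^m, since param_vec maps the parameters bijectively onto R^m
   (param_vec_bij below). *)
definition convex_wrt_params ::
  "nat \<Rightarrow> (nat \<Rightarrow> nat) \<Rightarrow> nat \<Rightarrow> nat \<Rightarrow> (real mat list \<Rightarrow> real mat) \<Rightarrow> bool" where
  "convex_wrt_params n d r c F \<longleftrightarrow>
     (\<forall>W\<in>param_space n d. F W \<in> carrier_mat r c) \<and>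
     (\<forall>i<r. \<forall>j<c. \<exists>g. convex_on_vec (param_dim n d) g \<and>
        (\<forall>W\<in>param_space n d. F W $$ (i, j) = g (param_vec W)))"

(* XX is the set of admissible inputs; the outputs are r x c matrices. *)
definition PCNN ::
  "real mat set \<Rightarrow> nat \<Rightarrow> (nat \<Rightarrow> nat) \<Rightarrow> nat \<Rightarrow> nat \<Rightarrow>
     (real mat \<Rightarrow> real mat list \<Rightarrow> real mat) \<Rightarrow> bool" where
  "PCNN XX n d r c F \<longleftrightarrow> (\<forall>X\<in>XX. convex_wrt_params n d r c (F X))"

definition positive_mats :: "nat \<Rightarrow> nat \<Rightarrow> real mat set" where
  "positive_mats r c = {X \<in> carrier_mat r c. \<forall>i<r. \<forall>j<c. X $$ (i, j) > 0}"

lemma length_concat_const: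
  "(\<And>x. x \<in> set xss \<Longrightarrow> length x = c) \<Longrightarrow> length (concat xss) = length xss * c"
  by (induction xss) auto

lemma concat_const_nth:
  assumes "\<And>x. x \<in> set xss \<Longrightarrow> length x = c" "i < length xss" "j < c"
  shows "concat xss ! (i * c + j) = xss ! i ! j"
  using assms
proof (induction xss arbitrary: i)
  case (Cons a xss)
  then show ?case by (cases i) (auto simp: nth_append)
qed simp

lemma mat_list_length:
  "M \<in> carrier_mat r c \<Longrightarrow> length (concat (mat_to_list M)) = r * c"
  by (subst length_concat_const[where c = c]) (auto simp: mat_to_list_def)

lemma mat_list_nth:
  assumes "M \<in> carrier_mat r c" "i < r" "j < c"
  shows "concat (mat_to_list M) ! (i * c + j) = M $$ (i, j)"
  using assms by (subst concat_const_nth) (auto simp: mat_to_list_def)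

lemma mat_list_inj:
  assumes "M \<in> carrier_mat r c" "M' \<in> carrier_mat r c"
    "concat (mat_to_list M) = concat (mat_to_list M')"
  shows "M = M'"
  by (rule eq_matI) (use assms mat_list_nth in \<open>metis carrier_matD\<close>)+

lemma mat_list_surj:
  assumes "length xs = r * c"
  shows "\<exists>M\<in>carrier_mat r c. concat (mat_to_list M) = xs"
proof
  let ?M = "mat r c (\<lambda>(i, j). xs ! (i * c + j))"
  show M: "?M \<in> carrier_mat r c" by simp
  show "concat (mat_to_list ?M) = xs"
  proof (rule nth_equalityI)
    show "length (concat (mat_to_list ?M)) = length xs"
      using mat_list_length[OF M] assms by simp
    fix l assume "l < length (concat (mat_to_list ?M))"
    then have l: "l < r * c" using mat_list_length[OF M] by simp
    then have c: "c > 0" by (cases c) auto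
    have i: "l div c < r" using l by (simp add: less_mult_imp_div_less)
    have j: "l mod c < c" using c by simp
    show "concat (mat_to_list ?M) ! l = xs ! l"
      using mat_list_nth[OF M i j] i j by simp
  qed
qed

lemma param_space_Suc:
  "W \<in> param_space (Suc n) d \<longleftrightarrow>
     (\<exists>V M. W = V @ [M] \<and> V \<in> param_space n d \<and> M \<in> carrier_mat (d n) (d (Suc n)))"
proof
  assume W: "W \<in> param_space (Suc n) d"
  then obtain V M where VM: "W = V @ [M]"
    by (cases W rule: rev_cases) (auto simp: param_space_def)
  with W have n: "length V = n" and c: "\<forall>k<Suc n. W ! k \<in> carrier_mat (d k) (d (Suc k))"
    by (auto simp: param_space_def)
  have "V ! k \<in> carrier_mat (d k) (d (Suc k))" if "k < n" for k
    using c[rule_format, of k] that VM n by (simp add: nth_append)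
  moreover have "M \<in> carrier_mat (d n) (d (Suc n))"
    using c[rule_format, of n] VM n by (simp add: nth_append)
  ultimately show "\<exists>V M. W = V @ [M] \<and> V \<in> param_space n d \<and> M \<in> carrier_mat (d n) (d (Suc n))"
    using VM n by (auto simp: param_space_def)
qed (auto simp: param_space_def nth_append less_Suc_eq)

lemma param_list_bij:
  "bij_betw (\<lambda>W. concat (map (\<lambda>M. concat (mat_to_list M)) W))
     (param_space n d) {xs. length xs = param_dim n d}"
proof (induction n)
  case 0
  then show ?case by (auto simp: param_space_def param_dim_def bij_betw_def)
next
  case (Suc n)
  let ?f = "\<lambda>W. concat (map (\<lambda>M. concat (mat_to_list M)) W)"
  have len: "length (?f V) = param_dim n d" if "V \<in> param_space n d" for V
    using bij_betwE[OF Suc] that by blast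
  have dim: "param_dim (Suc n) d = param_dim n d + d n * d (Suc n)"
    by (simp add: param_dim_def)
  show ?case unfolding bij_betw_def
  proof (intro conjI inj_onI subset_antisym subsetI)
    fix W W' assume W: "W \<in> param_space (Suc n) d" "W' \<in> param_space (Suc n) d"
      and eq: "?f W = ?f W'"
    from W obtain V M V' M' where *: "W = V @ [M]" "W' = V' @ [M']"
      "V \<in> param_space n d" "V' \<in> param_space n d"
      "M \<in> carrier_mat (d n) (d (Suc n))" "M' \<in> carrier_mat (d n) (d (Suc n))"
      unfolding param_space_Suc by blast
    have "?f V = ?f V' \<and> concat (mat_to_list M) = concat (mat_to_list M')"
      using eq * len by simp
    then show "W = W'"
      using * mat_list_inj bij_betw_imp_inj_on[OF Suc] by (metis inj_onD)
  next
    fix xs assume "xs \<in> ?f ` param_space (Suc n) d"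
    then show "xs \<in> {xs. length xs = param_dim (Suc n) d}"
      by (auto simp: param_space_Suc dim len[simplified] mat_list_length)
  next
    fix xs :: "real list" assume "xs \<in> {xs. length xs = param_dim (Suc n) d}"
    then have l: "length (take (param_dim n d) xs) = param_dim n d"
      "length (drop (param_dim n d) xs) = d n * d (Suc n)"
      by (auto simp: dim)
    have "take (param_dim n d) xs \<in> ?f ` param_space n d"
      unfolding bij_betw_imp_surj_on[OF Suc] using l(1) by simp
    then obtain V where V: "V \<in> param_space n d" "?f V = take (param_dim n d) xs"
      by (auto elim!: imageE)
    obtain M where M: "M \<in> carrier_mat (d n) (d (Suc n))"
      "concat (mat_to_list M) = drop (param_dim n d) xs"
      using mat_list_surj[OF l(2)] by blast
    show "xs \<in> ?f ` param_space (Suc n) d"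
    proof (rule image_eqI)
      show "xs = ?f (V @ [M])" using V(2) M(2) by simp
      show "V @ [M] \<in> param_space (Suc n) d"
        unfolding param_space_Suc using V(1) M(1) by blast
    qed
  qed
qed

lemma param_vec_bij:
  "bij_betw param_vec (param_space n d) (carrier_vec (param_dim n d))"
proof -
  have "bij_betw vec_of_list {xs :: real list. length xs = m} (carrier_vec m)" for m
    by (rule bij_betwI[where g = list_of_vec]) (auto simp: list_vec vec_list intro: carrier_vecI)
  from bij_betw_trans[OF param_list_bij this]
  show ?thesis by (simp add: param_vec_def[abs_def] comp_def)
qed

end

(* A nonnegative function h on a real vector space with
   h(u x + v y) \<le> h(x)^u h(y)^v  (u, v > 0, u + v = 1)
   is convex by the weighted AM-GM inequality.  This class of functions contains the
   nonnegative constants and the entries of a^W, and it is closed under products, under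
   sums (Hoelder) and under composition with \<sigma>: the condition
   \<sigma>'' \<sigma> \<ge> \<sigma>'^2 makes ln \<sigma> convex, and with the monotonicity of \<sigma> and AM-GM this gives
   \<sigma>(x^u y^v) \<le> \<sigma>(u x + v y) \<le> \<sigma>(x)^u \<sigma>(y)^v.
   Hence it is preserved from layer to layer.  Zeros have to be allowed, since an isolated
   vertex gives a zero row of the adjacency matrix. *)
theory Submission
  imports Defs "HOL-Analysis.Convex"
begin

section \<open>Weighted AM-GM and Hoelder inequalities\<close>

lemma weighted_am_gm:
  fixes u v x y :: real
  assumes "u > 0" "v > 0" "u + v = 1" "x \<ge> 0" "y \<ge> 0"
  shows "x powr u * y powr v \<le> u * x + v * y"
  \<comment> \<open>Young's inequality covers positive \<open>x\<close> and \<open>y\<close>;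
    otherwise the left side is 0, because \<open>0 powr u = 0\<close>.\<close>
  using assms Youngs_inequality_0[of u v x y] by (cases "x = 0 \<or> y = 0") auto

text \<open>Hoelder's inequality with exponents 1/u and 1/v for the families
  \<open>x i powr u\<close> and \<open>y i powr v\<close>. Dividing \<open>x\<close> and
  \<open>y\<close> by their sums reduces it to AM-GM in each term.\<close>

lemma Hoelder_sum_powr:
  fixes x y :: "'a \<Rightarrow> real"
  assumes "finite I" "u > 0" "v > 0" "u + v = 1"
    and "\<And>i. i \<in> I \<Longrightarrow> x i \<ge> 0" "\<And>i. i \<in> I \<Longrightarrow> y i \<ge> 0"
  shows "(\<Sum>i\<in>I. x i powr u * y i powr v) \<le> (\<Sum>i\<in>I. x i) powr u * (\<Sum>i\<in>I. y i) powr v"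
proof -
  define S T where "S = sum x I" and "T = sum y I"
  have "S \<ge> 0" "T \<ge> 0" unfolding S_def T_def using assms by (auto intro: sum_nonneg)
  show ?thesis
  proof (cases "S = 0 \<or> T = 0")
    \<comment> \<open>A vanishing sum cannot be normalised, but it forces all its nonnegative terms,
      hence the left side, to be 0.\<close>
    case True
    then have "(\<forall>i\<in>I. x i = 0) \<or> (\<forall>i\<in>I. y i = 0)"
      unfolding S_def T_def using assms by (simp add: sum_nonneg_eq_0_iff)
    then have "(\<Sum>i\<in>I. x i powr u * y i powr v) = 0"
      by (intro sum.neutral) auto
    then show ?thesis by simp
  next
    case False
    with \<open>S \<ge> 0\<close> \<open>T \<ge> 0\<close> have pos: "S > 0" "T > 0" by auto
    have "x i powr u * y i powr v \<le> (u * (x i / S) + v * (y i / T)) * (S powr u * T powr v)"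
      if "i \<in> I" for i
    proof -
      have "x i powr u * y i powr v
          = ((x i / S) powr u * (y i / T) powr v) * (S powr u * T powr v)"
        using pos assms that by (simp add: powr_divide)
      also have "\<dots> \<le> (u * (x i / S) + v * (y i / T)) * (S powr u * T powr v)"
        using pos assms that by (intro mult_right_mono weighted_am_gm) auto
      finally show ?thesis .
    qed
    then have "(\<Sum>i\<in>I. x i powr u * y i powr v)
        \<le> (\<Sum>i\<in>I. (u * (x i / S) + v * (y i / T)) * (S powr u * T powr v))"
      by (rule sum_mono)
    also have "\<dots> = (u * (sum x I / S) + v * (sum y I / T)) * (S powr u * T powr v)"
      by (simp only: sum_divide_distrib sum_distrib_left sum_distrib_right sum.distrib[symmetric])
    \<comment> \<open>The normalised families sum to 1, so the first factor is
      \<open>u + v = 1\<close>.\<close>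
    finally show ?thesis using pos assms by (simp add: S_def T_def)
  qed
qed

section \<open>The activation function on the nonnegative reals\<close>

context
  fixes \<sigma> \<sigma>' \<sigma>'' :: "real \<Rightarrow> real"
  assumes deriv: "\<And>t. (\<sigma> has_real_derivative \<sigma>' t) (at t)"
    and deriv2: "\<And>t. (\<sigma>' has_real_derivative \<sigma>'' t) (at t)"
    and pos: "\<And>t. t > 0 \<Longrightarrow> \<sigma> t > 0"
    and pos': "\<And>t. t > 0 \<Longrightarrow> \<sigma>' t > 0"
    and log_convex: "\<And>t. t > 0 \<Longrightarrow> \<sigma>'' t * \<sigma> t \<ge> (\<sigma>' t)\<^sup>2"
begin

lemma activation_mono:
  assumes "0 \<le> x" "x \<le> y"
  shows "\<sigma> x \<le> \<sigma> y"
proof (cases "x = y")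
  case False
  \<comment> \<open>The mean value point lies strictly to the right of \<open>x\<close>, so
    \<open>\<sigma>' z > 0\<close> is available even for \<open>x = 0\<close>.\<close>
  with assms obtain z where "x < z" "\<sigma> y - \<sigma> x = (y - x) * \<sigma>' z"
    using MVT2[of x y \<sigma> \<sigma>'] deriv by auto
  moreover have "\<sigma>' z > 0" using pos' assms \<open>x < z\<close> by simp
  ultimately show ?thesis using assms by (smt (verit) mult_nonneg_nonneg)
qed simp

text \<open>Positivity is assumed for positive arguments; by continuity \<open>\<sigma> 0\<close> is
  a limit of such values from the right.\<close>

lemma activation_nonneg:
  assumes "0 \<le> x"
  shows "0 \<le> \<sigma> x"
proof (cases "x = 0")
  case True
  have "isCont \<sigma> 0" using deriv DERIV_isCont by blast
  then have "(\<sigma> \<longlongrightarrow> \<sigma> 0) (at_right 0)"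
    unfolding isCont_def using filterlim_at_split by blast
  moreover have "\<forall>\<^sub>F t in at_right 0. 0 \<le> \<sigma> t"
    using pos by (auto simp: eventually_at_filter less_imp_le)
  ultimately have "0 \<le> \<sigma> 0" by (rule tendsto_lowerbound) simp
  with True show ?thesis by simp
qed (use assms pos in \<open>auto intro: less_imp_le\<close>)

text \<open>By the quotient rule the second derivative of ln \<sigma> is (\<sigma>'' \<sigma> -
  \<sigma>'^2) / \<sigma>^2, whose numerator is nonnegative by \<open>log_convex\<close>.\<close>

lemma convex_on_ln_activation: "convex_on {0<..} (\<lambda>t. ln (\<sigma> t))"
proof (rule f''_ge0_imp_convex)
  fix t :: real assume "t \<in> {0<..}"
  then have t: "\<sigma> t > 0" "t > 0" using pos by auto
  show "((\<lambda>t. ln (\<sigma> t)) has_real_derivative \<sigma>' t / \<sigma> t) (at t)"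
    using t by (auto intro!: derivative_eq_intros deriv)
  show "((\<lambda>t. \<sigma>' t / \<sigma> t) has_real_derivative (\<sigma>'' t * \<sigma> t - \<sigma>' t * \<sigma>' t) / (\<sigma> t * \<sigma> t)) (at t)"
    using t by (intro DERIV_divide deriv deriv2) auto
  show "0 \<le> (\<sigma>'' t * \<sigma> t - \<sigma>' t * \<sigma>' t) / (\<sigma> t * \<sigma> t)"
    using log_convex[OF t(2)] by (simp add: power2_eq_square)
qed simp

text \<open>Matrix products bound their entries by a geometric mean without equality, hence the
  separate \<open>z\<close>; monotonicity of \<sigma> absorbs the gap.\<close>

lemma activation_geometric:
  assumes uv: "u > 0" "v > 0" "u + v = 1"
    and "0 \<le> x" "0 \<le> y" "0 \<le> z" and z: "z \<le> x powr u * y powr v"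
  shows "\<sigma> z \<le> \<sigma> x powr u * \<sigma> y powr v"
proof (cases "x = 0 \<or> y = 0")
  \<comment> \<open>Convexity of ln \<sigma> is known for positive arguments. Here the bound forces
    \<open>z = 0\<close>; as \<open>\<sigma> 0\<close> may be positive, it is split into its powers
    with exponents \<open>u\<close> and \<open>v\<close>, which monotonicity compares.\<close>
  case True
  with assms have "z = 0" by auto
  have le: "\<sigma> 0 \<le> \<sigma> x" "\<sigma> 0 \<le> \<sigma> y" "0 \<le> \<sigma> 0"
    using assms activation_mono activation_nonneg by auto
  have "\<sigma> z = \<sigma> 0 powr u * \<sigma> 0 powr v"
    using uv le by (simp add: \<open>z = 0\<close> flip: powr_add)
  also have "\<dots> \<le> \<sigma> x powr u * \<sigma> y powr v"
    using uv le by (intro mult_mono powr_mono2) auto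
  finally show ?thesis .
next
  case False
  with assms have xy: "x > 0" "y > 0" by auto
  with uv have c: "u * x + v * y > 0" by (simp add: add_pos_pos)
  have "z \<le> u * x + v * y"
    using z weighted_am_gm[OF uv] assms by (meson order_trans)
  then have "\<sigma> z \<le> \<sigma> (u * x + v * y)"
    using assms by (intro activation_mono)
  also have "\<dots> = exp (ln (\<sigma> (u * x + v * y)))"
    using pos c by simp
  also have "\<dots> \<le> exp (u * ln (\<sigma> x) + v * ln (\<sigma> y))"
    using convex_on_ln_activation uv xy by (auto simp: convex_on_def)
  also have "\<dots> = \<sigma> x powr u * \<sigma> y powr v"
    using pos[OF xy(1)] pos[OF xy(2)] by (simp add: powr_def exp_add)
  finally show ?thesis .
qed

end

section \<open>Geometric domination of matrices\<close>

text \<open>\<open>D\<close> stands for the value of a matrix-valued function at a convex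
  combination of two parameters, \<open>B\<close> and \<open>C\<close> for its values at these two
  parameters. Closure properties of the function class thus become statements about triples of
  matrices.\<close>

definition geo_dominated ::
  "real \<Rightarrow> real \<Rightarrow> nat \<Rightarrow> nat \<Rightarrow> real mat \<Rightarrow> real mat \<Rightarrow> real mat \<Rightarrow> bool" where
  "geo_dominated u v r c D B C \<longleftrightarrow>
     D \<in> carrier_mat r c \<and> B \<in> carrier_mat r c \<and> C \<in> carrier_mat r c \<and>
     (\<forall>i<r. \<forall>j<c. 0 \<le> D $$ (i, j) \<and> 0 \<le> B $$ (i, j) \<and> 0 \<le> C $$ (i, j) \<and>
        D $$ (i, j) \<le> B $$ (i, j) powr u * C $$ (i, j) powr v)"

text \<open>For matrices that do not depend on the parameters, namely the adjacency matrix and the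
  input: x^u x^v = x^(u+v) = x.\<close>

lemma geo_dominated_const:
  assumes "u + v = 1" "M \<in> carrier_mat r c" "\<And>i j. i < r \<Longrightarrow> j < c \<Longrightarrow> 0 \<le> M $$ (i, j)"
  shows "geo_dominated u v r c M M M"
  using assms by (auto simp: geo_dominated_def simp flip: powr_add)

text \<open>The bound is an equality here, since a^(u w + v w') = (a^w)^u (a^w')^v.\<close>

lemma geo_dominated_entrywise_powr:
  assumes "a > 0" "W \<in> carrier_mat r c" "W' \<in> carrier_mat r c"
  shows "geo_dominated u v r c (entrywise_powr a (u \<cdot>\<^sub>m W + v \<cdot>\<^sub>m W'))
           (entrywise_powr a W) (entrywise_powr a W')"
  using assms by (auto simp: geo_dominated_def entrywise_powr_def powr_powr powr_add mult.commute)

lemma index_mult_mat_sum: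
  assumes "B \<in> carrier_mat r m" "B' \<in> carrier_mat m c" "i < r" "j < c"
  shows "(B * B') $$ (i, j) = (\<Sum>k<m. B $$ (i, k) * B' $$ (k, j))"
  using assms by (simp add: scalar_prod_def atLeast0LessThan)

text \<open>An entry of the product is a sum of products: the geometric bounds multiply term by
  term, and Hoelder's inequality handles the sum.\<close>

lemma geo_dominated_mult:
  assumes uv: "u > 0" "v > 0" "u + v = 1"
    and 1: "geo_dominated u v r m D B C" and 2: "geo_dominated u v m c D' B' C'"
  shows "geo_dominated u v r c (D * D') (B * B') (C * C')"
  unfolding geo_dominated_def
proof (intro conjI allI impI)
  note car1 = 1[unfolded geo_dominated_def, THEN conjunct1]
    1[unfolded geo_dominated_def, THEN conjunct2, THEN conjunct1]
    1[unfolded geo_dominated_def, THEN conjunct2, THEN conjunct2, THEN conjunct1]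
  note car2 = 2[unfolded geo_dominated_def, THEN conjunct1]
    2[unfolded geo_dominated_def, THEN conjunct2, THEN conjunct1]
    2[unfolded geo_dominated_def, THEN conjunct2, THEN conjunct2, THEN conjunct1]
  show "D * D' \<in> carrier_mat r c" "B * B' \<in> carrier_mat r c" "C * C' \<in> carrier_mat r c"
    using car1 car2 by auto
  fix i j assume ij: "i < r" "j < c"
  note sums = index_mult_mat_sum[OF car1(1) car2(1) ij] index_mult_mat_sum[OF car1(2) car2(2) ij]
    index_mult_mat_sum[OF car1(3) car2(3) ij]
  have e1: "0 \<le> D $$ (i, k)" "0 \<le> B $$ (i, k)" "0 \<le> C $$ (i, k)"
    "D $$ (i, k) \<le> B $$ (i, k) powr u * C $$ (i, k) powr v" if "k < m" for k
    using 1 ij that unfolding geo_dominated_def by blast+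
  have e2: "0 \<le> D' $$ (k, j)" "0 \<le> B' $$ (k, j)" "0 \<le> C' $$ (k, j)"
    "D' $$ (k, j) \<le> B' $$ (k, j) powr u * C' $$ (k, j) powr v" if "k < m" for k
    using 2 ij that unfolding geo_dominated_def by blast+
  show "0 \<le> (D * D') $$ (i, j)" "0 \<le> (B * B') $$ (i, j)" "0 \<le> (C * C') $$ (i, j)"
    unfolding sums using e1 e2 by (auto intro!: sum_nonneg)
  have "(\<Sum>k<m. D $$ (i, k) * D' $$ (k, j))
      \<le> (\<Sum>k<m. (B $$ (i, k) * B' $$ (k, j)) powr u * (C $$ (i, k) * C' $$ (k, j)) powr v)"
  proof (rule sum_mono)
    fix k assume "k \<in> {..<m}"
    then have k: "k < m" by simp
    have "D $$ (i, k) * D' $$ (k, j)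
        \<le> (B $$ (i, k) powr u * C $$ (i, k) powr v) * (B' $$ (k, j) powr u * C' $$ (k, j) powr v)"
      using e1[OF k] e2[OF k] by (intro mult_mono) auto
    also have "\<dots> = (B $$ (i, k) * B' $$ (k, j)) powr u * (C $$ (i, k) * C' $$ (k, j)) powr v"
      using e1[OF k] e2[OF k] by (simp add: powr_mult mult_ac)
    finally show "D $$ (i, k) * D' $$ (k, j)
        \<le> (B $$ (i, k) * B' $$ (k, j)) powr u * (C $$ (i, k) * C' $$ (k, j)) powr v" .
  qed
  also have "\<dots> \<le> (\<Sum>k<m. B $$ (i, k) * B' $$ (k, j)) powr u * (\<Sum>k<m. C $$ (i, k) * C' $$ (k, j)) powr v"
    using e1 e2 by (intro Hoelder_sum_powr uv) auto
  finally show "(D * D') $$ (i, j) \<le> (B * B') $$ (i, j) powr u * (C * C') $$ (i, j) powr v"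
    unfolding sums .
qed

lemma geo_dominated_map:
  assumes "geo_dominated u v r c D B C"
    and "\<And>x. 0 \<le> x \<Longrightarrow> 0 \<le> f x"
    and "\<And>x y z. \<lbrakk>0 \<le> x; 0 \<le> y; 0 \<le> z; z \<le> x powr u * y powr v\<rbrakk> \<Longrightarrow> f z \<le> f x powr u * f y powr v"
  shows "geo_dominated u v r c (map_mat f D) (map_mat f B) (map_mat f C)"
  using assms by (auto simp: geo_dominated_def)

section \<open>Convex combinations of parameters and their flattening\<close>

definition comb_params :: "real \<Rightarrow> real \<Rightarrow> real mat list \<Rightarrow> real mat list \<Rightarrow> real mat list" where
  "comb_params u v W W' = map2 (\<lambda>M M'. u \<cdot>\<^sub>m M + v \<cdot>\<^sub>m M') W W'"

lemma nth_comb_params: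
  assumes "W \<in> param_space n d" "W' \<in> param_space n d" "k < n"
  shows "comb_params u v W W' ! k = u \<cdot>\<^sub>m (W ! k) + v \<cdot>\<^sub>m (W' ! k)"
  using assms by (simp add: comb_params_def param_space_def)

lemma comb_params_in_param_space:
  assumes "W \<in> param_space n d" "W' \<in> param_space n d"
  shows "comb_params u v W W' \<in> param_space n d"
  using assms by (auto simp: param_space_def comb_params_def)

lemma mat_list_comb:
  assumes "M \<in> carrier_mat r c" "M' \<in> carrier_mat r c"
  shows "concat (mat_to_list (u \<cdot>\<^sub>m M + v \<cdot>\<^sub>m M')) =
    map2 (\<lambda>x y. u * x + v * y) (concat (mat_to_list M)) (concat (mat_to_list M'))"
proof (rule nth_equalityI)
  have M: "u \<cdot>\<^sub>m M + v \<cdot>\<^sub>m M' \<in> carrier_mat r c" using assms by simp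
  show "length (concat (mat_to_list (u \<cdot>\<^sub>m M + v \<cdot>\<^sub>m M'))) =
    length (map2 (\<lambda>x y. u * x + v * y) (concat (mat_to_list M)) (concat (mat_to_list M')))"
    by (simp add: mat_list_length[OF M] mat_list_length[OF assms(1)] mat_list_length[OF assms(2)])
  fix l assume "l < length (concat (mat_to_list (u \<cdot>\<^sub>m M + v \<cdot>\<^sub>m M')))"
  then have l: "l < r * c" using mat_list_length[OF M] by simp
  \<comment> \<open>Position \<open>l\<close> of the row-major list is the entry in row
    \<open>l div c\<close> and column \<open>l mod c\<close>.\<close>
  then have i: "l div c < r" by (simp add: less_mult_imp_div_less)
  have j: "l mod c < c" using l by (cases c) auto
  show "concat (mat_to_list (u \<cdot>\<^sub>m M + v \<cdot>\<^sub>m M')) ! l =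
    map2 (\<lambda>x y. u * x + v * y) (concat (mat_to_list M)) (concat (mat_to_list M')) ! l"
    using mat_list_nth[OF M i j] mat_list_nth[OF assms(1) i j] mat_list_nth[OF assms(2) i j]
      mat_list_length[OF assms(1)] mat_list_length[OF assms(2)] l i j assms
    by simp
qed

lemma param_list_comb:
  fixes n :: nat and d :: "nat \<Rightarrow> nat"
  defines "f \<equiv> \<lambda>W. concat (map (\<lambda>M. concat (mat_to_list M)) W)"
  assumes "W \<in> param_space n d" "W' \<in> param_space n d"
  shows "f (comb_params u v W W') = map2 (\<lambda>x y. u * x + v * y) (f W) (f W')"
  using assms(2,3)
proof (induction n arbitrary: W W')
  case 0
  then show ?case by (simp add: f_def param_space_def comb_params_def)
next
  case (Suc n)
  then obtain V M V' M' where *: "W = V @ [M]" "W' = V' @ [M']"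
    "V \<in> param_space n d" "V' \<in> param_space n d"
    "M \<in> carrier_mat (d n) (d (Suc n))" "M' \<in> carrier_mat (d n) (d (Suc n))"
    unfolding param_space_Suc by blast
  \<comment> \<open>Equal lengths of the prefixes let \<open>map2\<close> split across both
    appends.\<close>
  have len: "length (f V) = length (f V')" "length V = length V'"
    using bij_betwE[OF param_list_bij] * by (auto simp: f_def param_space_def)
  have "f (comb_params u v W W') =
      f (comb_params u v V V') @ concat (mat_to_list (u \<cdot>\<^sub>m M + v \<cdot>\<^sub>m M'))"
    using * len by (simp add: f_def comb_params_def)
  also have "\<dots> = map2 (\<lambda>x y. u * x + v * y) (f V @ concat (mat_to_list M))
      (f V' @ concat (mat_to_list M'))"
    using Suc.IH[OF *(3,4)] mat_list_comb[OF *(5,6)] len by simp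
  finally show ?case by (simp add: f_def *)
qed

text \<open>Compatibility of flattening with linear combinations lets convexity on R^m be checked on
  lists of matrices.\<close>

lemma param_vec_comb:
  assumes "W \<in> param_space n d" "W' \<in> param_space n d"
  shows "param_vec (comb_params u v W W') = u \<cdot>\<^sub>v param_vec W + v \<cdot>\<^sub>v param_vec W'"
  using param_list_comb[OF assms] bij_betwE[OF param_list_bij] assms
  by (intro eq_vecI) (auto simp: param_vec_def vec_of_list_index)

text \<open>The witness for \<open>g\<close> is the entry of \<open>F\<close> composed with the
  inverse of \<open>param_vec\<close>. Only positive weights are left to the user, as the
  inequalities above are stated for these.\<close>

lemma convex_wrt_paramsI:
  assumes car: "\<And>W. W \<in> param_space n d \<Longrightarrow> F W \<in> carrier_mat r c"
    and conv: "\<And>W W' u v i j. \<lbrakk>W \<in> param_space n d; W' \<in> param_space n d; u > 0; v > 0; u + v = 1;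
      i < r; j < c\<rbrakk> \<Longrightarrow> F (comb_params u v W W') $$ (i, j) \<le> u * F W $$ (i, j) + v * F W' $$ (i, j)"
  shows "convex_wrt_params n d r c F"
  unfolding convex_wrt_params_def
proof (intro conjI ballI allI impI car)
  fix i j assume ij: "i < r" "j < c"
  let ?h = "inv_into (param_space n d) param_vec"
  let ?g = "\<lambda>x. F (?h x) $$ (i, j)"
  have h: "?h (param_vec W) = W" if "W \<in> param_space n d" for W
    using param_vec_bij that by (metis bij_betw_inv_into_left)
  have "?g (u \<cdot>\<^sub>v x + v \<cdot>\<^sub>v y) \<le> u * ?g x + v * ?g y"
    if xy: "x \<in> carrier_vec (param_dim n d)" "y \<in> carrier_vec (param_dim n d)"
      and uv: "u \<ge> 0" "v \<ge> 0" "u + v = 1" for x y u v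
  proof -
    obtain W W' where W: "W \<in> param_space n d" "W' \<in> param_space n d"
      "x = param_vec W" "y = param_vec W'"
      using xy param_vec_bij by (metis bij_betw_def imageE)
    \<comment> \<open>With a zero weight the combination is one of the endpoints and the inequality
      is an equality.\<close>
    consider "u = 0" "v = 1" | "v = 0" "u = 1" | "u > 0" "v > 0"
      using uv by linarith
    then show ?thesis
    proof cases
      case 1
      then have "u \<cdot>\<^sub>v x + v \<cdot>\<^sub>v y = y" using xy by auto
      with 1 show ?thesis by simp
    next
      case 2
      then have "u \<cdot>\<^sub>v x + v \<cdot>\<^sub>v y = x" using xy by auto
      with 2 show ?thesis by simp
    next
      case 3
      have "?h (u \<cdot>\<^sub>v x + v \<cdot>\<^sub>v y) = comb_params u v W W'"
        using h[OF comb_params_in_param_space[OF W(1,2)]] param_vec_comb[OF W(1,2)] W(3,4) by simp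
      then show ?thesis
        using conv[OF W(1,2) 3 uv(3) ij] h W by simp
    qed
  qed
  then have "convex_on_vec (param_dim n d) ?g" by (auto simp: convex_on_vec_def)
  then show "\<exists>g. convex_on_vec (param_dim n d) g \<and>
      (\<forall>W\<in>param_space n d. F W $$ (i, j) = g (param_vec W))"
    using h by (intro exI[of _ ?g]) simp
qed

section \<open>Induction over the layers\<close>

theorem theorem6:
  fixes \<sigma> \<sigma>' \<sigma>'' :: "real \<Rightarrow> real" and a :: real
    and G :: "(nat, 'e) pre_digraph" and N n :: nat and d :: "nat \<Rightarrow> nat"
  assumes "a > 0" and "a \<noteq> 1"
    and "\<And>t. (\<sigma> has_real_derivative \<sigma>' t) (at t)"
    and "\<And>t. (\<sigma>' has_real_derivative \<sigma>'' t) (at t)"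
    and "\<And>t. t > 0 \<Longrightarrow> \<sigma> t > 0"
    and "\<And>t. t > 0 \<Longrightarrow> \<sigma>' t > 0"
    and "\<And>t. t > 0 \<Longrightarrow> \<sigma>'' t > 0"
    and "\<And>t. t > 0 \<Longrightarrow> \<sigma>'' t * \<sigma> t \<ge> (\<sigma>' t)\<^sup>2"
    and "fin_digraph G" and "verts G = {0..<N}"
    and "n \<ge> 1" and "\<And>k. k \<le> n \<Longrightarrow> d k \<ge> 1"
  shows "PCNN (positive_mats N (d 0)) n d N (d n) (exp_gcn \<sigma> a (adjacency_mat N G) n)"
  unfolding PCNN_def
proof
  fix X assume X: "X \<in> positive_mats N (d 0)"
  define A where "A = adjacency_mat N G"
  \<comment> \<open>The entries are arc counts and therefore nonnegative.\<close>
  have A: "geo_dominated u v N N A A A" if "u + v = 1" for u v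
    using that by (intro geo_dominated_const) (auto simp: A_def adjacency_mat_def)
  \<comment> \<open>The induction runs over the products before activation, so that the output
    layer, to which \<sigma> is not applied, is the instance \<open>k = n - 1\<close>.\<close>
  have pre: "geo_dominated u v N (d (Suc k))
      (A * gcn_layer \<sigma> a A X (comb_params u v W W') k * entrywise_powr a (comb_params u v W W' ! k))
      (A * gcn_layer \<sigma> a A X W k * entrywise_powr a (W ! k))
      (A * gcn_layer \<sigma> a A X W' k * entrywise_powr a (W' ! k))"
    if W: "W \<in> param_space n d" "W' \<in> param_space n d" and uv: "u > 0" "v > 0" "u + v = 1"
      and "k < n" for u v k W W'
    using \<open>k < n\<close>
  proof (induction k)
    case 0
    have "geo_dominated u v N (d 0) X X X"
      using X uv by (intro geo_dominated_const) (auto simp: positive_mats_def less_imp_le)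
    then show ?case
      using A[OF uv(3)] geo_dominated_entrywise_powr[OF \<open>a > 0\<close>] W 0
      by (auto simp: nth_comb_params[OF W] param_space_def intro!: geo_dominated_mult[OF uv])
  next
    case (Suc k)
    \<comment> \<open>Applying \<sigma> to the three matrices of the induction hypothesis gives the
      next layer.\<close>
    then have "geo_dominated u v N (d (Suc k)) (gcn_layer \<sigma> a A X (comb_params u v W W') (Suc k))
      (gcn_layer \<sigma> a A X W (Suc k)) (gcn_layer \<sigma> a A X W' (Suc k))"
      unfolding gcn_layer.simps
      using activation_nonneg[OF assms(3-6,8)] activation_geometric[OF assms(3-6,8) uv]
      by (intro geo_dominated_map) simp_all
    moreover have "W ! Suc k \<in> carrier_mat (d (Suc k)) (d (Suc (Suc k)))"
      "W' ! Suc k \<in> carrier_mat (d (Suc k)) (d (Suc (Suc k)))"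
      using W Suc.prems by (auto simp: param_space_def)
    ultimately show ?case
      unfolding nth_comb_params[OF W Suc.prems]
      by (blast intro: geo_dominated_mult[OF uv] A[OF uv(3)] geo_dominated_entrywise_powr[OF \<open>a > 0\<close>])
  qed
  have out: "geo_dominated u v N (d n) (exp_gcn \<sigma> a A n X (comb_params u v W W'))
      (exp_gcn \<sigma> a A n X W) (exp_gcn \<sigma> a A n X W')"
    if "W \<in> param_space n d" "W' \<in> param_space n d" "u > 0" "v > 0" "u + v = 1" for u v W W'
    using pre[OF that, of "n - 1"] \<open>n \<ge> 1\<close> by (simp add: exp_gcn_def)
  show "convex_wrt_params n d N (d n) (exp_gcn \<sigma> a (adjacency_mat N G) n X)"
    unfolding A_def[symmetric]
  proof (rule convex_wrt_paramsI)
    fix W assume "W \<in> param_space n d"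
    then show "exp_gcn \<sigma> a A n X W \<in> carrier_mat N (d n)"
      \<comment> \<open>Combining \<open>W\<close> with itself serves only to read off the
        dimensions of the output.\<close>
      using out[of W W "1/2" "1/2"] by (simp add: geo_dominated_def)
  next
    fix W W' i j and u v :: real
    assume *: "W \<in> param_space n d" "W' \<in> param_space n d" "u > 0" "v > 0" "u + v = 1"
      and ij: "i < N" "j < d n"
    let ?f = "\<lambda>W. exp_gcn \<sigma> a A n X W $$ (i, j)"
    \<comment> \<open>Domination gives the geometric mean as an upper bound; AM-GM replaces it by
      the arithmetic mean.\<close>
    have "?f (comb_params u v W W') \<le> ?f W powr u * ?f W' powr v" "0 \<le> ?f W" "0 \<le> ?f W'"
      using out[OF *] ij unfolding geo_dominated_def by blast+
    then show "?f (comb_params u v W W') \<le> u * ?f W + v * ?f W'"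
      using weighted_am_gm[OF *(3-5)] by (meson order_trans)
  qed
qed

end
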